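(* For every integer $n\ge1$, $$\nu_2(s_n-1)=\nu_2(n)+2 ,$$ where $s_n$ are the signed odd Springer numbers defined in the context.
   Context: $\nu_2$ is the normalized $2$-adic valuation. Let $\chi_8(m)=\left(\frac2m\right)$ be the primitive even quadratic character modulo $8$ (so $\chi_8(m)=1,-1,-1,1$ for $m\equiv1,3,5,7\pmod 8$ and $0$ for even $m$) with its Dirichlet $L$-function $L(s,\chi_8)$. Define $$s_n:=\frac{L(-2n-1,\chi_8)}{L(-1,\chi_8)}\qquad(n\ge0).$$ Equivalently, these are the numbers with exponential generating function $$\sum_{n\ge0}s_n\frac{x^{2n+1}}{(2n+1)!}=\frac{\sinh x}{\cosh 2x},$$ so that $s_0=1$, $s_1=-11$. *)

theory Defs
  imports "HOL-Complex_Analysis.Complex_Analysis" "HOL-Computational_Algebra.Factorial_Ring"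
begin

definition chi8 :: "nat \<Rightarrow> complex" where
  "chi8 m = (if m mod 8 \<in> {1, 7} then 1 else if m mod 8 \<in> {3, 5} then -1 else 0)"

text \<open>
  The Dirichlet L-function of a non-principal character \<open>c\<close>: the (unique) entire function that is
  given by the Dirichlet series on the half-plane of absolute convergence. The summand for
  \<open>m = 0\<close> vanishes, because \<open>0 powr z = 0\<close>. For a principal character, whose L-function has a
  pole at 1, the definition is meaningless.
\<close>
definition Dirichlet_L :: "(nat \<Rightarrow> complex) \<Rightarrow> complex \<Rightarrow> complex" where
  "Dirichlet_L c = (THE F. F holomorphic_on UNIV \<and>
     (\<forall>s. Re s > 1 \<longrightarrow> (\<lambda>m. c m * of_nat m powr (- s)) sums F s))"

definition springer :: "nat \<Rightarrow> complex" where
  "springer n = Dirichlet_L chi8 (- 2 * of_nat n - 1) / Dirichlet_L chi8 (- 1)"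

text \<open>The normalized 2-adic valuation of a nonzero rational; at 0 it takes the junk value 0.\<close>
definition nu2 :: "rat \<Rightarrow> int" where
  "nu2 r = (case quotient_of r of (a, b) \<Rightarrow> int (multiplicity 2 a) - int (multiplicity 2 b))"

end

theory Submission
  imports Defs
begin

text \<open>
  Everything follows from the closed formula
  \<open>s\<^sub>n = (\<Sum>k\<le>2n+1. (2n+1 choose k) 2\<^sup>k E\<^sub>k)\<close> with the (integral) Euler numbers \<open>E\<^sub>k\<close>.
  As the odd Euler numbers vanish, it reads \<open>s\<^sub>n - 1 = - 4n(2n+1) + \<dots>\<close>, where
  the term \<open>k = 2\<close> is shown and the remaining terms have even \<open>k = 2j \<ge> 4\<close>. Absorption gives
  \<open>j(2j-1) (2n+1 choose 2j) = n(2n+1) (2n-1 choose 2j-2)\<close>, so such a term loses at most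
  \<open>\<nu>\<^sub>2(j)\<close> against \<open>\<nu>\<^sub>2(n)\<close> but gains \<open>2j \<ge> \<nu>\<^sub>2(j) + 3\<close> from the power of two
  (\<open>even_binomial_dvd\<close>). Hence the term \<open>-4n(2n+1)\<close>, of valuation \<open>\<nu>\<^sub>2(n) + 2\<close>, dominates.

  The closed formula needs the entire continuation of the L-function. Pairing the
  residue classes modulo 4 gives \<open>L(s, \<chi>\<^sub>8) = A\<^sub>1(s) - A\<^sub>3(s)\<close> with the alternating series
  \<open>A\<^sub>c(s) = (\<Sum>k. (-1)\<^sup>k (4k+c)\<^sup>-\<^sup>s)\<close>. Applying Euler's series transformation \<open>N\<close> times replaces the
  terms by their \<open>N\<close>-th differences, which are of size \<open>k\<close> to the power \<open>- Re s - N\<close>; the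
  transformed series therefore continues \<open>A\<^sub>c\<close> holomorphically to \<open>Re s > 1 - N\<close>
  (\<open>holomorphic_euler_transform\<close>), and the continuations for different \<open>N\<close> agree.

  At \<open>s = -m\<close> the terms are a polynomial in \<open>k\<close>, high differences vanish, and the transformed
  series becomes a finite sum. That sum telescopes as soon as the terms are written as
  \<open>Q(k) + Q(k+1)\<close> for a polynomial \<open>Q\<close> (\<open>euler_transform_exact\<close>), and Euler polynomials provide
  exactly such a \<open>Q\<close>. For odd \<open>m\<close> the reflection symmetry of Euler polynomials merges the
  contributions of \<open>c = 1\<close> and \<open>c = 3\<close>.
\<close>

section \<open>Euler numbers and Euler polynomials\<close>

text \<open>
  The Taylor coefficients of \<open>1 / cosh\<close>, scaled by factorials.
\<close>
fun euler_number :: "nat \<Rightarrow> int" where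
  "euler_number l = (if l = 0 then 1 else if odd l then 0
     else - (\<Sum>k<l. int (l choose k) * euler_number k))"

declare euler_number.simps [simp del]

lemma euler_number_0 [simp]: "euler_number 0 = 1"
  by (simp add: euler_number.simps)

lemma euler_number_odd: "odd l \<Longrightarrow> euler_number l = 0"
  by (subst euler_number.simps) (auto dest: odd_pos)

lemma euler_number_2: "euler_number 2 = -1"
  by (subst euler_number.simps) (simp add: numeral_2_eq_2 euler_number_odd)

lemma euler_number_sum:
  assumes "even l" "l > 0"
  shows "(\<Sum>k\<le>l. int (l choose k) * euler_number k) = 0"
proof -
  have "euler_number l = - (\<Sum>k<l. int (l choose k) * euler_number k)"
    using assms by (subst euler_number.simps) auto
  thus ?thesis by (simp flip: lessThan_Suc_atMost)
qed

text \<open>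
  This is the coefficientwise form of \<open>(1 / cosh t) * (exp t + exp (- t)) = 2\<close>.
\<close>
lemma euler_number_sum_parity:
  "(\<Sum>k\<le>l. int (l choose k) * euler_number k * (1 + (-1) ^ (l - k))) = (if l = 0 then 2 else 0)"
proof (cases "odd l")
  case True
  have "int (l choose k) * euler_number k * (1 + (-1) ^ (l - k)) = 0" if "k \<le> l" for k
    using True that by (cases "odd k") (auto simp: euler_number_odd)
  with True show ?thesis by (auto intro!: sum.neutral)
next
  case False
  have "int (l choose k) * euler_number k * (1 + (-1) ^ (l - k)) = 2 * (int (l choose k) * euler_number k)"
    if "k \<le> l" for k
    using False that by (cases "odd k") (auto simp: euler_number_odd)
  hence "(\<Sum>k\<le>l. int (l choose k) * euler_number k * (1 + (-1) ^ (l - k)))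
      = 2 * (\<Sum>k\<le>l. int (l choose k) * euler_number k)"
    unfolding sum_distrib_left by (intro sum.cong) auto
  with False show ?thesis by (cases "l = 0") (auto simp: euler_number_sum)
qed

text \<open>
  In terms of the classical Euler polynomials this is \<open>4\<^sup>m E\<^sub>m((y + 2) / 4)\<close>. The scaling
  keeps the coefficients integral, and the centring at the symmetry point of \<open>E\<^sub>m\<close> makes the
  reflection formula a statement about parity.
\<close>
definition scaled_euler_poly :: "nat \<Rightarrow> complex \<Rightarrow> complex" where
  "scaled_euler_poly m y = (\<Sum>k\<le>m. of_nat (m choose k) * 2 ^ k * of_int (euler_number k) * y ^ (m - k))"

text \<open>
  The rescaled form of \<open>E\<^sub>m(z) + E\<^sub>m(z + 1) = 2 z\<^sup>m\<close>. After both binomial expansions the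
  coefficient of \<open>x\<^sup>m\<^sup>-\<^sup>l\<close> is \<open>(m choose l) 2\<^sup>l\<close> times the sum in \<open>euler_number_sum_parity\<close>, because
  \<open>(m choose k) (m-k choose l-k) = (m choose l) (l choose k)\<close>.
\<close>
lemma scaled_euler_poly_functional_eq: "scaled_euler_poly m (x - 2) + scaled_euler_poly m (x + 2) = 2 * x ^ m"
proof -
  let ?e = "\<lambda>k. of_int (euler_number k) :: complex"
  have bin: "(x - 2) ^ r + (x + 2) ^ r = (\<Sum>i\<le>r. of_nat (r choose i) * 2 ^ i * (1 + (-1) ^ i) * x ^ (r - i))" for r
  proof -
    have "(x + 2) ^ r = (\<Sum>i\<le>r. of_nat (r choose i) * 2 ^ i * x ^ (r - i))"
      using binomial_ring[of 2 x r] by (simp add: add.commute)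
    moreover have "(x - 2) ^ r = (\<Sum>i\<le>r. of_nat (r choose i) * ((-1) ^ i * 2 ^ i) * x ^ (r - i))"
      using binomial_ring[of "-2" x r] by (simp flip: power_mult_distrib)
    ultimately show ?thesis
      by (simp add: algebra_simps flip: sum.distrib)
  qed
  have "scaled_euler_poly m (x - 2) + scaled_euler_poly m (x + 2)
      = (\<Sum>k\<le>m. of_nat (m choose k) * 2 ^ k * ?e k * ((x - 2) ^ (m - k) + (x + 2) ^ (m - k)))"
    unfolding scaled_euler_poly_def by (simp add: algebra_simps flip: sum.distrib)
  also have "\<dots> = (\<Sum>k\<le>m. \<Sum>i\<le>m - k. of_nat (m choose k) * of_nat (m - k choose i) * 2 ^ (k + i) * ?e k * (1 + (-1) ^ i) * x ^ (m - (k + i)))"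
    unfolding bin by (simp add: sum_distrib_left mult_ac power_add)
  also have "\<dots> = (\<Sum>(k, i)\<in>{(k, i). k + i \<le> m}. of_nat (m choose k) * of_nat (m - k choose i) * 2 ^ (k + i) * ?e k * (1 + (-1) ^ i) * x ^ (m - (k + i)))"
    by (subst sum.Sigma) (auto intro!: sum.cong)
  also have "\<dots> = (\<Sum>l\<le>m. \<Sum>k\<le>l. of_nat (m choose k) * of_nat (m - k choose (l - k)) * 2 ^ l * ?e k * (1 + (-1) ^ (l - k)) * x ^ (m - l))"
    by (subst sum.triangle_reindex_eq) simp
  also have "\<dots> = (\<Sum>l\<le>m. of_nat (m choose l) * 2 ^ l * x ^ (m - l)
        * of_int (\<Sum>k\<le>l. int (l choose k) * euler_number k * (1 + (-1) ^ (l - k))))"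
  proof (rule sum.cong[OF refl])
    fix l assume "l \<in> {..m}"
    hence c: "of_nat (m choose k) * of_nat (m - k choose (l - k)) = (of_nat (m choose l) * of_nat (l choose k) :: complex)"
      if "k \<le> l" for k
      using choose_mult[of k l m] that by (simp flip: of_nat_mult)
    show "(\<Sum>k\<le>l. of_nat (m choose k) * of_nat (m - k choose (l - k)) * 2 ^ l * ?e k * (1 + (-1) ^ (l - k)) * x ^ (m - l))
        = of_nat (m choose l) * 2 ^ l * x ^ (m - l) * of_int (\<Sum>k\<le>l. int (l choose k) * euler_number k * (1 + (-1) ^ (l - k)))"
      by (simp add: c sum_distrib_left mult_ac)
  qed
  also have "\<dots> = (\<Sum>l\<le>m. if l = 0 then 2 * x ^ m else 0)"
    unfolding euler_number_sum_parity by (intro sum.cong) auto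
  also have "\<dots> = 2 * x ^ m" by simp
  finally show ?thesis .
qed

section \<open>Iterated differences\<close>

text \<open>
  The sign is opposite to that of the usual forward difference: with \<open>\<Delta> g k = g k - g (k + 1)\<close>
  the shift is \<open>1 - \<Delta>\<close>, so that alternating sums produce no extra signs.
\<close>
primrec fdiff :: "nat \<Rightarrow> (nat \<Rightarrow> complex) \<Rightarrow> nat \<Rightarrow> complex" where
  "fdiff 0 g = g"
| "fdiff (Suc N) g = fdiff N (\<lambda>k. g k - g (Suc k))"

lemma fdiff_linear: "fdiff N (\<lambda>k. a * f k + b * g k) k = a * fdiff N f k + b * fdiff N g k"
proof (induction N arbitrary: f g)
  case (Suc N)
  have "(\<lambda>k. a * f k + b * g k - (a * f (Suc k) + b * g (Suc k))) =
    (\<lambda>k. a * (f k - f (Suc k)) + b * (g k - g (Suc k)))" by (simp add: algebra_simps)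
  then show ?case by (simp add: Suc)
qed simp

lemma fdiff_shift: "fdiff N (\<lambda>k. g (k + d)) k = fdiff N g (k + d)"
  by (induction N arbitrary: g) auto

lemma fdiff_Suc: "fdiff (Suc N) g k = fdiff N g k - fdiff N g (Suc k)"
  using fdiff_linear[of N 1 g "-1" "\<lambda>k. g (Suc k)" k] fdiff_shift[of N g 1 k] by simp

lemma fdiff_zero: "fdiff N (\<lambda>_. 0) = (\<lambda>_. 0)"
  by (induction N) auto

text \<open>
  Multiplication by a linear factor costs one more difference, by the discrete Leibniz rule
  \<open>\<Delta>(l g) k = l(k) \<Delta> g k - a g (k + 1)\<close> for \<open>l(k) = a k + b\<close>.
\<close>
lemma fdiff_linear_mult:
  assumes "fdiff N g = (\<lambda>_. 0)"
  shows "fdiff (Suc N) (\<lambda>k. (a * of_nat k + b) * g k) = (\<lambda>_. 0)"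
  using assms
proof (induction N arbitrary: g)
  case 0
  then show ?case by auto
next
  case (Suc N)
  let ?h = "\<lambda>k. g k - g (Suc k)"
  have eq: "(\<lambda>k. (a * of_nat k + b) * g k - (a * of_nat (Suc k) + b) * g (Suc k))
     = (\<lambda>k. 1 * ((a * of_nat k + b) * ?h k) + (-a) * g (k + 1))"
    by (simp add: algebra_simps)
  have "fdiff (Suc N) (\<lambda>k. (a * of_nat k + b) * ?h k) = (\<lambda>_. 0)"
    using Suc.IH[of ?h] Suc.prems by simp
  moreover have "fdiff (Suc N) (\<lambda>k. g (k + 1)) = (\<lambda>_. 0)"
    using Suc.prems fdiff_shift[of "Suc N" g 1] by (intro ext) simp
  ultimately show ?case
    unfolding fdiff.simps(2)[of "Suc N"] eq by (intro ext) (simp only: fdiff_linear, simp)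
qed

lemma fdiff_power: "d < N \<Longrightarrow> fdiff N (\<lambda>k. (a * of_nat k + b) ^ d) = (\<lambda>_. 0)"
proof (induction d arbitrary: N)
  case 0
  then show ?case by (cases N) (auto simp: fdiff_zero)
next
  case (Suc d)
  then obtain M where M: "N = Suc M" "d < M" by (cases N) auto
  show ?case using fdiff_linear_mult[OF Suc.IH[OF M(2)], of a b] M by simp
qed

lemma fdiff_sum: "fdiff N (\<lambda>k. \<Sum>i\<in>I. c i * f i k) k = (\<Sum>i\<in>I. c i * fdiff N (f i) k)"
proof (induction I rule: infinite_finite_induct)
  case (insert i I)
  then show ?case using fdiff_linear[of N "c i" "f i" 1 "\<lambda>k. \<Sum>i\<in>I. c i * f i k" k] by simp
qed (auto simp: fdiff_zero)

text \<open>
  Each difference with step \<open>h\<close> is worth \<open>h\<close> times a derivative, by the mean value inequality.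
  The sequence \<open>G\<close> lists the successive derivatives of \<open>G 0\<close>; the induction replaces it by
  \<open>z \<mapsto> G i z - G i (z + h)\<close>, and a half-line is stable under the shift by \<open>h\<close>.
\<close>
lemma norm_fdiff_le:
  fixes G :: "nat \<Rightarrow> complex \<Rightarrow> complex" and x h :: real
  assumes h: "h \<ge> 0"
    and d: "\<And>i z. i < N \<Longrightarrow> z \<in> \<real> \<Longrightarrow> x \<le> Re z \<Longrightarrow> (G i has_field_derivative G (Suc i) z) (at z)"
    and B: "\<And>z. z \<in> \<real> \<Longrightarrow> x \<le> Re z \<Longrightarrow> norm (G N z) \<le> B"
  shows "norm (fdiff N (\<lambda>k. G 0 (of_real (x + h * real k))) 0) \<le> h ^ N * B"
  using d B
proof (induction N arbitrary: G B)
  case 0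
  then show ?case by simp
next
  case (Suc N)
  define H where "H = (\<lambda>i z. G i z - G i (z + of_real h))"
  define S where "S = {z. z \<in> \<real> \<and> x \<le> Re z}"
  have "S = \<real> \<inter> {z. Re z \<ge> x}" by (auto simp: S_def)
  hence "convex S"
    by (simp add: convex_Int convex_Reals convex_halfspace_Re_ge)
  have "(H i has_field_derivative H (Suc i) z) (at z)" if "i < N" "z \<in> \<real>" "x \<le> Re z" for i z
  proof -
    have 1: "(G i has_field_derivative G (Suc i) z) (at z)"
      using Suc.prems(1)[of i z] that by simp
    have "(G i has_field_derivative G (Suc i) (z + of_real h)) (at (z + of_real h))"
      using Suc.prems(1)[of i "z + of_real h"] that h by (simp add: complex_is_Real_iff)
    hence "((\<lambda>z. G i (z + of_real h)) has_field_derivative G (Suc i) (z + of_real h)) (at z)"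
      by (simp add: DERIV_shift)
    from DERIV_diff[OF 1 this] show ?thesis by (simp add: H_def)
  qed
  moreover have "norm (H N z) \<le> h * B" if "z \<in> \<real>" "x \<le> Re z" for z
  proof -
    have "norm (G N (z + of_real h) - G N z) \<le> B * norm (z + of_real h - z)"
    proof (rule field_differentiable_bound[OF \<open>convex S\<close>])
      show "(G N has_field_derivative G (Suc N) z) (at z within S)" if "z \<in> S" for z
        using Suc.prems(1)[of N z] that by (auto simp: S_def intro: has_field_derivative_at_within)
      show "norm (G (Suc N) z) \<le> B" if "z \<in> S" for z
        using Suc.prems(2)[of z] that by (auto simp: S_def)
    qed (use that h in \<open>auto simp: S_def complex_is_Real_iff\<close>)
    thus ?thesis using h by (simp add: H_def norm_minus_commute mult.commute)
  qed
  ultimately have "norm (fdiff N (\<lambda>k. H 0 (of_real (x + h * real k))) 0) \<le> h ^ N * (h * B)"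
    by (rule Suc.IH)
  thus ?case by (simp add: H_def algebra_simps)
qed

section \<open>Euler's series transformation\<close>

text \<open>
  The alternating sum of \<open>g\<close> after \<open>N\<close> applications of Euler's transformation. For \<open>N = 0\<close>
  it is the alternating sum itself.
\<close>
definition euler_transform :: "nat \<Rightarrow> (nat \<Rightarrow> complex) \<Rightarrow> complex" where
  "euler_transform N g =
     (\<Sum>j<N. fdiff j g 0 / 2 ^ Suc j) + (\<Sum>k. (-1) ^ k * fdiff N g k) / 2 ^ N"

text \<open>
  Shifting the index gives
  \<open>(\<Sum>k. (-1)\<^sup>k h k) = h 0 / 2 + (\<Sum>k. (-1)\<^sup>k (h k - h (k + 1))) / 2\<close> for a convergent series; this is
  applied to the tail, with \<open>h\<close> the \<open>N\<close>-th difference of \<open>g\<close>.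
\<close>
lemma euler_transform_Suc:
  assumes "summable (\<lambda>k. (-1) ^ k * fdiff N g k)"
  shows "euler_transform (Suc N) g = euler_transform N g"
proof -
  define h where "h = fdiff N g"
  define S where "S = (\<Sum>k. (-1) ^ k * h k)"
  have S: "(\<lambda>k. (-1) ^ k * h k) sums S"
    using assms by (auto simp: S_def h_def)
  have "(\<lambda>k. (-1) ^ Suc k * h (Suc k)) sums (S - h 0)"
    using sums_Suc_iff[of "\<lambda>k. (-1) ^ k * h k" "S - h 0"] S by simp
  from sums_add[OF S this]
  have "(\<lambda>k. (-1) ^ k * fdiff (Suc N) g k) sums (2 * S - h 0)"
    by (simp add: fdiff_Suc h_def algebra_simps del: fdiff.simps)
  hence "(\<Sum>k. (-1) ^ k * fdiff (Suc N) g k) = 2 * S - h 0"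
    by (rule sums_unique[symmetric])
  thus ?thesis
    unfolding euler_transform_def sum.lessThan_Suc
    by (simp only:) (simp add: S_def h_def diff_divide_distrib)
qed

text \<open>
  Writing \<open>g = Q + (shift of Q) = 2 Q - \<Delta> Q\<close> turns the finite part into a telescoping sum, and
  the vanishing difference removes both its last term and the infinite tail.
\<close>
lemma euler_transform_exact:
  assumes g: "\<And>k. g k = Q k + Q (Suc k)" and Q: "fdiff N Q = (\<lambda>_. 0)"
  shows "euler_transform N g = Q 0"
proof -
  have d: "fdiff j g k = 2 * fdiff j Q k - fdiff (Suc j) Q k" for j k
  proof -
    have "g = (\<lambda>k. 1 * Q k + 1 * Q (k + 1))" using g by auto
    hence "fdiff j g k = fdiff j Q k + fdiff j Q (Suc k)"
      using fdiff_linear[of j 1 Q 1 "\<lambda>k. Q (k + 1)" k] fdiff_shift[of j Q 1 k] by simp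
    thus ?thesis by (simp add: fdiff_Suc del: fdiff.simps)
  qed
  have "fdiff N g = (\<lambda>_. 0)"
    using Q by (auto simp: d fdiff_Suc simp del: fdiff.simps)
  moreover have "(\<Sum>j<N. fdiff j g 0 / 2 ^ Suc j) = Q 0 - fdiff N Q 0 / 2 ^ N"
  proof -
    have "fdiff j g 0 / 2 ^ Suc j = fdiff j Q 0 / 2 ^ j - fdiff (Suc j) Q 0 / 2 ^ Suc j" for j
      by (simp add: d diff_divide_distrib del: fdiff.simps)
    thus ?thesis
      using sum_lessThan_telescope'[of "\<lambda>j. fdiff j Q 0 / 2 ^ j" N] by simp
  qed
  ultimately show ?thesis by (simp add: euler_transform_def Q)
qed

section \<open>Continuation of the alternating Dirichlet series\<close>

definition alt_term :: "nat \<Rightarrow> complex \<Rightarrow> nat \<Rightarrow> complex" where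
  "alt_term c s k = of_nat (4 * k + c) powr (- s)"

text \<open>
  The \<open>N\<close>-th derivative of \<open>z\<^sup>-\<^sup>s\<close> is \<open>(-1)\<^sup>N\<close> times the Pochhammer symbol of \<open>s\<close> times
  \<open>z\<^sup>-\<^sup>s\<^sup>-\<^sup>N\<close>; its modulus decreases
  along the half-line when \<open>Re s + N \<ge> 0\<close>, so the value at the left end bounds it. The
  factor \<open>4\<^sup>N\<close> comes from the step length \<open>4\<close>.
\<close>
lemma norm_fdiff_alt_term_le:
  assumes c: "c > 0" and s: "Re s + real N \<ge> 0"
  shows "norm (fdiff N (alt_term c s) k) \<le> 4 ^ N * norm (pochhammer s N) * real (Suc k) powr (- Re s - real N)"
proof -
  define G where "G = (\<lambda>i z. (-1) ^ i * pochhammer s i * z powr (- s - of_nat i) :: complex)"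
  define x where "x = real (4 * k + c)"
  define B where "B = norm (pochhammer s N) * real (Suc k) powr (- Re s - real N)"
  have x: "x \<ge> real (Suc k)" "x > 0" using c by (auto simp: x_def)
  have "norm (fdiff N (\<lambda>j. G 0 (of_real (x + 4 * real j))) 0) \<le> 4 ^ N * B"
  proof (rule norm_fdiff_le)
    fix i z assume z: "z \<in> \<real>" "x \<le> Re z"
    hence "z \<notin> \<real>\<^sub>\<le>\<^sub>0" using x by (auto simp: complex_nonpos_Reals_iff)
    have p: "pochhammer s (Suc i) = pochhammer s i * (s + of_nat i)"
      by (simp add: pochhammer_Suc)
    show "(G i has_field_derivative G (Suc i) z) (at z)"
      unfolding G_def p
      by (rule DERIV_cong[OF DERIV_cmult[OF has_field_derivative_powr[OF \<open>z \<notin> \<real>\<^sub>\<le>\<^sub>0\<close>]]])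
         (simp add: algebra_simps)
  next
    fix z assume z: "z \<in> \<real>" "x \<le> Re z"
    hence "norm (G N z) = norm (pochhammer s N) * Re z powr (- Re s - real N)"
      using x by (simp add: G_def norm_mult norm_power norm_powr_real_powr)
    also have "\<dots> \<le> B"
      unfolding B_def using z x s by (intro mult_left_mono powr_mono2') auto
    finally show "norm (G N z) \<le> B" .
  qed simp
  also have "(\<lambda>j. G 0 (of_real (x + 4 * real j))) = (\<lambda>j. alt_term c s (j + k))"
    by (simp add: G_def x_def alt_term_def algebra_simps)
  also have "fdiff N (\<lambda>j. alt_term c s (j + k)) 0 = fdiff N (alt_term c s) k"
    by (simp add: fdiff_shift)
  finally show ?thesis by (simp add: B_def mult.assoc)
qed

lemma summable_Suc_powr: "a < -1 \<Longrightarrow> summable (\<lambda>k. real (Suc k) powr a)"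
  by (subst summable_Suc_iff) (simp add: summable_real_powr_iff)

lemma summable_fdiff_alt_term:
  assumes c: "c > 0" and s: "Re s > 1 - real N"
  shows "summable (\<lambda>k. (-1) ^ k * fdiff N (alt_term c s) k)"
proof (rule summable_comparison_test')
  show "summable (\<lambda>k. 4 ^ N * norm (pochhammer s N) * real (Suc k) powr (- Re s - real N))"
    using s by (intro summable_mult summable_Suc_powr) auto
  show "norm ((-1) ^ k * fdiff N (alt_term c s) k) \<le> 4 ^ N * norm (pochhammer s N) * real (Suc k) powr (- Re s - real N)"
    if "k \<ge> 0" for k
    using norm_fdiff_alt_term_le[OF c, of s N k] s by (simp add: norm_mult norm_power)
qed

lemma holomorphic_fdiff:
  assumes "\<And>k. (\<lambda>s. g s k) holomorphic_on A"
  shows "(\<lambda>s. fdiff N (g s) k) holomorphic_on A"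
  using assms
proof (induction N arbitrary: g)
  case (Suc N)
  then show ?case by (auto intro!: Suc.IH holomorphic_on_diff)
qed simp

lemma holomorphic_fdiff_alt_term:
  assumes "c > 0"
  shows "(\<lambda>s. fdiff N (alt_term c s) k) holomorphic_on A"
proof (rule holomorphic_fdiff)
  show "(\<lambda>s. alt_term c s k) holomorphic_on A" for k
    unfolding alt_term_def using assms by (intro holomorphic_intros) (auto simp flip: of_nat_mult of_nat_add)
qed

text \<open>
  The bound in \<open>norm_fdiff_alt_term_le\<close> is locally uniform in \<open>s\<close>, so the tail is a locally
  uniformly convergent series of entire functions.
\<close>
lemma holomorphic_euler_transform:
  assumes c: "c > 0"
  shows "(\<lambda>s. euler_transform N (alt_term c s)) holomorphic_on {s. Re s > 1 - real N}"
proof -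
  let ?S = "{s. Re s > 1 - real N}"
  let ?f = "\<lambda>k s. (-1) ^ k * fdiff N (alt_term c s) k"
  have S: "open ?S" by (rule open_halfspace_Re_gt)
  have hol: "?f k holomorphic_on UNIV" for k
    by (intro holomorphic_intros holomorphic_fdiff_alt_term c)
  have "\<exists>g g'. \<forall>s\<in>?S. ((\<lambda>k. ?f k s) sums g s) \<and> ((\<lambda>k. deriv (?f k) s) sums g' s) \<and>
          (g has_field_derivative g' s) (at s)"
  proof (rule series_and_derivative_comparison_complex[OF S])
    show "(?f k has_field_derivative deriv (?f k) s) (at s)" for k s
      using hol[of k] by (intro holomorphic_derivI[of _ UNIV]) auto
  next
    fix x assume x: "x \<in> ?S"
    define d where "d = (Re x - (1 - real N)) / 2"
    define r where "r = Re x - d"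
    have d: "d > 0" and r: "r > 1 - real N" using x by (auto simp: d_def r_def field_simps)
    have "continuous_on (cball x d) (\<lambda>s. pochhammer s N)"
      unfolding pochhammer_prod by (intro continuous_intros)
    hence "compact ((\<lambda>s. pochhammer s N) ` cball x d)"
      by (rule compact_continuous_image) auto
    then obtain C where C: "\<And>y. y \<in> cball x d \<Longrightarrow> norm (pochhammer y N) \<le> C"
      by (force dest!: compact_imp_bounded simp: bounded_iff)
    have "C \<ge> 0" using C[of x] d norm_ge_zero order_trans by (metis centre_in_cball less_imp_le)
    define h where "h = (\<lambda>k. 4 ^ N * C * real (Suc k) powr (- r - real N))"
    have "norm (?f k y) \<le> h k" if "y \<in> ball x d" for k y
    proof -
      have "\<bar>Re y - Re x\<bar> < d"
        using that abs_Re_le_cmod[of "y - x"] by (simp add: dist_norm norm_minus_commute)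
      hence y: "Re y \<ge> r" by (simp add: r_def)
      hence "norm (?f k y) \<le> 4 ^ N * norm (pochhammer y N) * real (Suc k) powr (- Re y - real N)"
        using norm_fdiff_alt_term_le[OF c, of y N k] r by (simp add: norm_mult norm_power)
      also have "\<dots> \<le> h k"
        unfolding h_def using C[of y] that y \<open>C \<ge> 0\<close>
        by (intro mult_mono mult_left_mono powr_mono) auto
      finally show ?thesis .
    qed
    moreover have "h k \<ge> 0" for k using \<open>C \<ge> 0\<close> by (simp add: h_def)
    moreover have "summable h" unfolding h_def using r by (intro summable_mult summable_Suc_powr) auto
    ultimately show "\<exists>d h. 0 < d \<and> summable h \<and> range h \<subseteq> \<real>\<^sub>\<ge>\<^sub>0 \<and>
        (\<forall>\<^sub>F k in sequentially. \<forall>y\<in>ball x d \<inter> ?S. cmod (?f k y) \<le> cmod (h k))"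
      using d by (intro exI[of _ d] exI[of _ "\<lambda>k. complex_of_real (h k)"])
                 (auto intro!: summable_of_real always_eventually)
  qed
  then obtain g g' where g: "\<And>s. s \<in> ?S \<Longrightarrow> (\<lambda>k. ?f k s) sums g s"
    "\<And>s. s \<in> ?S \<Longrightarrow> (g has_field_derivative g' s) (at s)" by blast
  have "g holomorphic_on ?S"
    using g(2) S by (auto simp: holomorphic_on_open)
  moreover have "g s = (\<Sum>k. ?f k s)" if "s \<in> ?S" for s
    using g(1)[OF that] by (rule sums_unique)
  ultimately have "(\<lambda>s. \<Sum>k. ?f k s) holomorphic_on ?S"
    by (rule holomorphic_transform)
  thus ?thesis
    unfolding euler_transform_def
    by (intro holomorphic_intros holomorphic_fdiff_alt_term c) auto
qed

text \<open>
  The entire continuation of the alternating series. The number of transformation steps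
  depends on \<open>s\<close> and is large enough for absolute convergence; by \<open>alt_zeta_eq\<close> any other
  number with this property gives the same value.
\<close>
definition alt_zeta :: "nat \<Rightarrow> complex \<Rightarrow> complex" where
  "alt_zeta c s = euler_transform (nat \<lceil>2 - Re s\<rceil>) (alt_term c s)"

lemma alt_zeta_eq:
  assumes c: "c > 0" and s: "Re s > 1 - real N"
  shows "alt_zeta c s = euler_transform N (alt_term c s)"
proof -
  have *: "euler_transform M (alt_term c s) = euler_transform K (alt_term c s)"
    if "Re s > 1 - real K" "K \<le> M" for K M
    using that(2)
  proof (induction M rule: dec_induct)
    case (step M)
    have "summable (\<lambda>k. (-1) ^ k * fdiff M (alt_term c s) k)"
      using that(1) step by (intro summable_fdiff_alt_term c) auto
    thus ?case using step euler_transform_Suc by simp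
  qed simp
  define M where "M = nat \<lceil>2 - Re s\<rceil>"
  have "Re s > 1 - real M" unfolding M_def by linarith
  thus ?thesis using *[of N M] *[of M N] s by (cases "N \<le> M") (auto simp: alt_zeta_def M_def)
qed

lemma holomorphic_alt_zeta:
  assumes c: "c > 0"
  shows "alt_zeta c holomorphic_on UNIV"
proof -
  have "alt_zeta c holomorphic_on {s. Re s > 1 - real N}" for N
    by (rule holomorphic_transform[OF holomorphic_euler_transform[OF c]]) (simp add: alt_zeta_eq[OF c])
  hence "alt_zeta c holomorphic_on (\<Union>N. {s. Re s > 1 - real N})"
    by (intro holomorphic_on_UN_open) (auto simp: open_halfspace_Re_gt)
  moreover have "(\<Union>N. {s. Re s > 1 - real N}) = UNIV"
  proof (intro equalityI subsetI)
    fix s :: complex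
    obtain N where "real N > 1 - Re s" using reals_Archimedean2 by blast
    thus "s \<in> (\<Union>N. {s. Re s > 1 - real N})" by (auto intro!: exI[of _ N])
  qed auto
  ultimately show ?thesis by simp
qed

text \<open>
  At \<open>x = 4k + c\<close> the functional equation of the Euler polynomials exhibits the term
  \<open>(4k + c)\<^sup>m\<close> in the form required by \<open>euler_transform_exact\<close>.
\<close>
lemma alt_zeta_neg_nat:
  assumes c: "c > 0"
  shows "alt_zeta c (- of_nat m) = scaled_euler_poly m (of_nat c - 2) / 2"
proof -
  define Q where "Q = (\<lambda>k. scaled_euler_poly m (4 * of_nat k + (of_nat c - 2)) / 2)"
  (* m + 2 is the least number of steps for which the point -m lies in the half-plane of convergence *)
  have "alt_zeta c (- of_nat m) = euler_transform (m + 2) (alt_term c (- of_nat m))"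
    by (rule alt_zeta_eq[OF c]) auto
  also have "\<dots> = Q 0"
  proof (rule euler_transform_exact)
    fix k
    have "of_nat (4 * k + c) \<noteq> (0 :: complex)"
      unfolding of_nat_eq_0_iff using c by simp
    from powr_complexpow[OF this, of m]
    have "alt_term c (- of_nat m) k = (4 * of_nat k + of_nat c) ^ m"
      by (simp add: alt_term_def)
    thus "alt_term c (- of_nat m) k = Q k + Q (Suc k)"
      using scaled_euler_poly_functional_eq[of m "4 * of_nat k + of_nat c"] by (simp add: Q_def algebra_simps flip: add_divide_distrib)
  next
    show "fdiff (m + 2) Q = (\<lambda>_. 0)"
    proof
      fix k
      have "Q = (\<lambda>k. \<Sum>i\<le>m. (of_nat (m choose i) * 2 ^ i * of_int (euler_number i) / 2) * (4 * of_nat k + (of_nat c - 2)) ^ (m - i))"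
        by (simp add: Q_def scaled_euler_poly_def sum_divide_distrib mult_ac)
      thus "fdiff (m + 2) Q k = 0"
        by (simp only: fdiff_sum) (simp add: fdiff_power del: fdiff.simps)
    qed
  qed
  finally show ?thesis by (simp add: Q_def)
qed

section \<open>The L-function of the even character modulo 8\<close>

text \<open>
  By the identity theorem the Dirichlet series has at most one entire continuation, so any
  such continuation is the value of the definite description.
\<close>
lemma Dirichlet_L_eqI:
  assumes hol: "F holomorphic_on UNIV"
    and sums: "\<And>s. Re s > 1 \<Longrightarrow> (\<lambda>m. c m * of_nat m powr (- s)) sums F s"
  shows "Dirichlet_L c = F"
  unfolding Dirichlet_L_def
proof (rule the_equality)
  fix G assume G: "G holomorphic_on UNIV \<and> (\<forall>s. Re s > 1 \<longrightarrow> (\<lambda>m. c m * of_nat m powr (- s)) sums G s)"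
  show "G = F"
  proof
    fix z
    have "2 \<in> {s. Re s > 1}" by simp
    hence "{s. Re s > 1} \<noteq> {}" by blast
    show "G z = F z"
      by (rule analytic_continuation_open[of "{s. Re s > 1}" UNIV])
         (use G hol sums \<open>{s. Re s > 1} \<noteq> {}\<close> in
           \<open>auto simp: open_halfspace_Re_gt intro: sums_unique2\<close>)
  qed
qed (use assms in auto)

lemma chi8_odd: "chi8 (4 * k + 1) = (-1) ^ k" "chi8 (4 * k + 3) = - ((-1) ^ k)"
proof -
  consider j where "k = 2 * j" | j where "k = 2 * j + 1" by (metis evenE oddE)
  hence "chi8 (4 * k + 1) = (-1) ^ k \<and> chi8 (4 * k + 3) = - ((-1) ^ k)"
    by cases (auto simp: chi8_def mod_mult_self4 distrib_left add.assoc)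
  thus "chi8 (4 * k + 1) = (-1) ^ k" "chi8 (4 * k + 3) = - ((-1) ^ k)" by auto
qed

lemma chi8_even: "even m \<Longrightarrow> chi8 m = 0"
  unfolding chi8_def by auto presburger+

text \<open>
  The character is \<open>(-1)\<^sup>k\<close> at \<open>4k + 1\<close> and \<open>-(-1)\<^sup>k\<close> at \<open>4k + 3\<close>, so in blocks of four the
  Dirichlet series is the difference of two alternating series.
\<close>
lemma Dirichlet_L_chi8: "Dirichlet_L chi8 = (\<lambda>s. alt_zeta 1 s - alt_zeta 3 s)"
proof (rule Dirichlet_L_eqI)
  show "(\<lambda>s. alt_zeta 1 s - alt_zeta 3 s) holomorphic_on UNIV"
    by (intro holomorphic_intros holomorphic_alt_zeta) auto
next
  fix s :: complex assume s: "Re s > 1"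
  let ?f = "\<lambda>m. chi8 m * of_nat m powr (- s)"
  have "summable ?f"
  proof (rule summable_comparison_test')
    show "summable (\<lambda>m. real m powr (- Re s))" using s by (simp add: summable_real_powr_iff)
    show "norm (?f m) \<le> real m powr (- Re s)" if "m \<ge> 0" for m
      by (auto simp: norm_mult norm_powr_real_powr chi8_def)
  qed
  have "sum ?f {k * 4..<k * 4 + 4} = (-1) ^ k * (alt_term 1 s k - alt_term 3 s k)" for k
  proof -
    have "{k * 4..<k * 4 + 4} = {4 * k, 4 * k + 1, 4 * k + 2, 4 * k + 3}" by auto
    thus ?thesis
      using chi8_odd[of k] by (simp add: chi8_even alt_term_def algebra_simps del: of_nat_add of_nat_mult)
  qed
  moreover have "(\<lambda>k. sum ?f {k * 4..<k * 4 + 4}) sums suminf ?f"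
    using \<open>summable ?f\<close> by (intro sums_group) auto
  ultimately have "(\<lambda>k. (-1) ^ k * (alt_term 1 s k - alt_term 3 s k)) sums suminf ?f" by simp
  moreover have "(\<lambda>k. (-1) ^ k * alt_term c s k) sums alt_zeta c s" if "c > 0" for c
    using summable_fdiff_alt_term[OF that, of 0 s] s alt_zeta_eq[OF that, of 0 s]
    by (auto simp: euler_transform_def dest: summable_sums)
  from sums_diff[OF this[of 1] this[of 3]]
  have "(\<lambda>k. (-1) ^ k * (alt_term 1 s k - alt_term 3 s k)) sums (alt_zeta 1 s - alt_zeta 3 s)"
    by (simp add: algebra_simps)
  ultimately have "suminf ?f = alt_zeta 1 s - alt_zeta 3 s" by (rule sums_unique2)
  with \<open>summable ?f\<close> show "?f sums (alt_zeta 1 s - alt_zeta 3 s)" using summable_sums by metis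
qed

lemma scaled_euler_poly_minus:
  assumes "odd m"
  shows "scaled_euler_poly m (- y) = - scaled_euler_poly m y"
  unfolding scaled_euler_poly_def sum_negf[symmetric]
proof (rule sum.cong[OF refl])
  fix k assume "k \<in> {..m}"
  with assms show "of_nat (m choose k) * 2 ^ k * of_int (euler_number k) * (- y) ^ (m - k) =
    - (of_nat (m choose k) * 2 ^ k * of_int (euler_number k) * y ^ (m - k))"
    by (cases "odd k") (auto simp: euler_number_odd power_minus[of y])
qed

text \<open>
  The two alternating series contribute the values of the same polynomial at \<open>1 - 2 = -1\<close> and
  \<open>3 - 2 = 1\<close>, which for odd \<open>m\<close> are negatives of each other.
\<close>
lemma Dirichlet_L_chi8_neg_odd:
  assumes "odd m"
  shows "Dirichlet_L chi8 (- of_nat m) = - scaled_euler_poly m 1"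
proof -
  have z1: "alt_zeta 1 (- of_nat m) = - scaled_euler_poly m 1 / 2"
    using alt_zeta_neg_nat[of 1 m] scaled_euler_poly_minus[OF assms, of 1] by simp
  have z3: "alt_zeta 3 (- of_nat m) = scaled_euler_poly m 1 / 2"
    using alt_zeta_neg_nat[of 3 m] by simp
  show ?thesis
    unfolding Dirichlet_L_chi8 z1 z3 by (simp add: field_simps)
qed

definition springer_int :: "nat \<Rightarrow> int" where
  "springer_int n = (\<Sum>k\<le>2 * n + 1. int (2 * n + 1 choose k) * 2 ^ k * euler_number k)"

text \<open>
  The sum is \<open>-L(-2n-1, \<chi>\<^sub>8)\<close>, and the normalizing value is \<open>L(-1, \<chi>\<^sub>8) = -1\<close>.
\<close>
lemma springer_eq: "springer n = of_int (springer_int n)"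
proof -
  have "Dirichlet_L chi8 (- 2 * of_nat n - 1) = - of_int (springer_int n)"
  proof -
    have arg: "- 2 * of_nat n - 1 = - complex_of_nat (2 * n + 1)" by simp
    have "scaled_euler_poly (2 * n + 1) 1 = of_int (springer_int n)"
      by (simp add: scaled_euler_poly_def springer_int_def mult_ac)
    thus ?thesis
      unfolding arg using Dirichlet_L_chi8_neg_odd[of "2 * n + 1"] by simp
  qed
  moreover have "Dirichlet_L chi8 (- 1) = - 1"
    using Dirichlet_L_chi8_neg_odd[of 1] by (simp add: scaled_euler_poly_def euler_number_odd)
  ultimately show ?thesis by (simp add: springer_def)
qed

section \<open>The 2-adic valuation\<close>

text \<open>
  With \<open>w = \<nu>\<^sub>2(j)\<close>, absorption shows that \<open>2\<^sup>v\<close> divides \<open>2\<^sup>w\<close> times the binomial coefficient.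
  The remaining power \<open>2\<^sup>2\<^sup>j\<close> makes up for this since \<open>w < 2\<^sup>w \<le> j\<close>, and \<open>w + 3 \<le> j + 2 \<le> 2j\<close>
  is where \<open>j \<ge> 2\<close> enters.
\<close>
lemma even_binomial_dvd:
  assumes n: "n > 0" and j: "j \<ge> 2" and v: "2 ^ v dvd n"
  shows "2 ^ (v + 3) dvd (2 * n + 1 choose (2 * j)) * 2 ^ (2 * j)"
proof -
  let ?C = "2 * n + 1 choose (2 * j)"
  obtain n' j' where nj: "n = Suc n'" "j = Suc j'" using n j by (metis gr0_conv_Suc less_le_trans pos2)
  have "Suc (Suc (2*n'+1)) * (Suc (2*n'+1) * ((2*n'+1) choose (2*j')))
     = (Suc (Suc (2*n'+1)) choose (Suc (Suc (2*j')))) * Suc (Suc (2 * j')) * Suc (2 * j')"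
    by (simp only: Suc_times_binomial_eq mult.assoc[symmetric])
  hence absorb: "j * (2 * j - 1) * ?C = n * ((2 * n + 1) * (2 * n - 1 choose (2 * j - 2)))"
    by (simp add: nj algebra_simps)
  define w where "w = multiplicity 2 j"
  obtain u where u: "j = 2 ^ w * u" "odd u"
    by (rule multiplicity_decompose'[of j 2, folded w_def, OF _ _ that]) (use j in auto)
  have "2 ^ v dvd (u * (2 * j - 1)) * (2 ^ w * ?C)"
  proof -
    have "(u * (2 * j - 1)) * (2 ^ w * ?C) = (2 ^ w * u) * (2 * j - 1) * ?C"
      by (simp only: mult_ac)
    also have "\<dots> = n * ((2 * n + 1) * (2 * n - 1 choose (2 * j - 2)))"
      unfolding u(1)[symmetric] by (rule absorb)
    finally show ?thesis using v by (simp only: dvd_mult2)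
  qed
  moreover have "coprime (2 ^ v) (u * (2 * j - 1))"
    using u(2) j by (simp add: coprime_power_left_iff)
  ultimately have "2 ^ v dvd 2 ^ w * ?C" by (simp add: coprime_dvd_mult_right_iff)
  hence 1: "2 ^ (v + 3) dvd 2 ^ (w + 3) * ?C" by (simp add: power_add mult.assoc mult_dvd_mono)
  have "2 ^ w \<le> j" using u by (cases u) auto
  hence "w + 3 \<le> 2 * j" using less_exp[of w] j by linarith
  hence "2 ^ (w + 3) * ?C dvd 2 ^ (2 * j) * ?C" by (intro mult_dvd_mono le_imp_power_dvd) auto
  from dvd_trans[OF 1 this] show ?thesis by (simp only: mult.commute)
qed

text \<open>
  The terms for \<open>k = 0\<close> and \<open>k = 2\<close> are \<open>1\<close> and \<open>-4n(2n+1)\<close>; those for odd \<open>k\<close> vanish,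
  and those for even \<open>k \<ge> 4\<close> are covered by \<open>even_binomial_dvd\<close>.
\<close>
lemma springer_int_cong:
  assumes n: "n > 0" and v: "2 ^ v dvd int n"
  shows "2 ^ (v + 3) dvd springer_int n - 1 + 4 * int n * (2 * int n + 1)"
proof -
  let ?t = "\<lambda>k. int (2 * n + 1 choose k) * 2 ^ k * euler_number k"
  have v': "2 ^ v dvd n"
    using v int_dvd_int_iff[of "2 ^ v" n] by simp
  have "{..2 * n + 1} = {0, 2} \<union> ({..2 * n + 1} - {0, 2})" using n by auto
  hence "springer_int n = sum ?t {0, 2} + sum ?t ({..2 * n + 1} - {0, 2})"
    unfolding springer_int_def by (metis (no_types, lifting) sum.union_disjoint Diff_disjoint finite_Diff finite_atMost finite.emptyI finite.insertI)
  moreover have "(2 * n + 1) choose 2 = n * (2 * n + 1)"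
    by (simp add: choose_two)
  ultimately have "springer_int n - 1 + 4 * int n * (2 * int n + 1) = sum ?t ({..2 * n + 1} - {0, 2})"
    by (simp add: euler_number_2 algebra_simps)
  moreover have "2 ^ (v + 3) dvd ?t k" if k: "k \<in> {..2 * n + 1} - {0, 2}" for k
  proof (cases "even k")
    case True
    then obtain j where j: "k = 2 * j" "j \<ge> 2" using k by (auto elim!: evenE)
    have "int (2 ^ (v + 3)) dvd int ((2 * n + 1 choose k) * 2 ^ k)"
      unfolding int_dvd_int_iff j(1) by (rule even_binomial_dvd[OF n j(2) v'])
    thus ?thesis by simp
  qed (simp add: euler_number_odd)
  ultimately show ?thesis by (metis (no_types, lifting) dvd_sum)
qed

text \<open>
  As \<open>2n+1\<close> is odd, \<open>4n(2n+1)\<close> is \<open>2\<^sup>v\<^sup>+\<^sup>2\<close> times an odd number for \<open>v = \<nu>\<^sub>2(n)\<close>, which a change by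
  a multiple of \<open>2\<^sup>v\<^sup>+\<^sup>3\<close> does not affect.
\<close>
lemma multiplicity_springer_int:
  assumes n: "n > 0"
  shows "springer_int n \<noteq> 1 \<and> multiplicity 2 (springer_int n - 1) = multiplicity 2 (int n) + 2"
proof -
  define v where "v = multiplicity 2 (int n)"
  obtain u where u: "int n = 2 ^ v * u" "odd u"
    by (rule multiplicity_decompose'[of "int n" 2, folded v_def, OF _ _ that]) (use n in auto)
  have "2 ^ v dvd int n" by (simp add: u(1))
  from springer_int_cong[OF n this] obtain t where
    t: "springer_int n - 1 + 4 * int n * (2 * int n + 1) = 2 ^ (v + 3) * t" by blast
  have eq: "springer_int n - 1 = 2 ^ (v + 2) * (2 * t - u * (2 * int n + 1))"
    using t by (simp add: u(1) algebra_simps power_add)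
  have odd: "odd (2 * t - u * (2 * int n + 1))" using u(2) by simp
  hence "2 * t - u * (2 * int n + 1) \<noteq> 0" by (metis even_zero)
  hence "springer_int n - 1 \<noteq> 0"
    unfolding eq by (metis mult_eq_0_iff power_not_zero zero_neq_numeral)
  moreover have "multiplicity 2 (springer_int n - 1) = v + 2"
    unfolding eq using odd by (intro multiplicity_decomposeI[OF refl]) auto
  ultimately show ?thesis by (simp add: v_def)
qed

lemma nu2_of_int: "nu2 (of_int k) = int (multiplicity 2 k)"
  by (simp add: nu2_def)

theorem corollary6p1:
  fixes n :: nat
  assumes "n \<ge> 1"
  shows "\<exists>r :: rat. springer n = of_rat r \<and> r \<noteq> 1 \<and> nu2 (r - 1) = nu2 (of_nat n) + 2"
proof (intro exI conjI)
  have m: "springer_int n \<noteq> 1" "multiplicity 2 (springer_int n - 1) = multiplicity 2 (int n) + 2"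
    using multiplicity_springer_int[of n] assms by auto
  show "springer n = of_rat (of_int (springer_int n))" by (simp add: springer_eq)
  show "(of_int (springer_int n) :: rat) \<noteq> 1" using m by simp
  have "nu2 (of_nat n) = int (multiplicity 2 (int n))"
    using nu2_of_int[of "int n"] by simp
  moreover have "nu2 (of_int (springer_int n) - 1) = int (multiplicity 2 (springer_int n - 1))"
    using nu2_of_int[of "springer_int n - 1"] by simp
  ultimately show "nu2 (of_int (springer_int n) - 1) = nu2 (of_nat n) + 2"
    using m by simp
qed

end
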